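(* Let $k$ be an algebraically closed field of characteristic zero, $B$ a finitely generated $k$-domain, $D$ a locally nilpotent $k$-derivation of $B$ with slice $s$ (i.e. $D(s)=1$), and $N\in\mathbb{Z}\setminus\{0\}$. Then the infinitesimal generator of Freudenburg's $\mathbb{G}_{\mathrm m}$-action $\beta_t=\exp(-\lambda D)\big|_{\lambda=(1-t^N)s}$ on $\operatorname{Spec}(B)$ is the derivation $\partial=NsD$.
   Context: A $k$-derivation $D$ of $B$ is locally nilpotent if for every $b\in B$ there is $m\ge1$ with $D^m(b)=0$. Let $\lambda$ be an indeterminate over $B$, with $D$ extended to $B[\lambda]$ by $D(\lambda)=0$; $\beta_t(b)$ is obtained by evaluating $\exp(-\lambda D)(b)=\sum_{j\ge0}\frac{(-\lambda)^j}{j!}D^j(b)$ at $\lambda=(1-t^N)s$, i.e. $\beta_t(b)=\sum_{j\ge0}\frac{(-(1-t^N)s)^j}{j!}D^j(b)$ for $b\in B$. The infinitesimal generator of a $\mathbb{G}_{\mathrm m}$-action with coaction $\beta^*:B\to B[t^{\pm1}]$, $b\mapsto\beta_t(b)$, is the derivation $\mathrm{ev}_1\circ\frac{d}{dt}\circ\beta^*$ of $B$, i.e. $b\mapsto\frac{d}{dt}\beta_t(b)\big|_{t=1}$. *)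

theory Defs
  imports "HOL-Computational_Algebra.Polynomial" "HOL-Library.Poly_Mapping"
begin

text \<open>
  A commutative algebra over a field is a commutative ring type \<open>'b\<close> together with the scalar
  multiplication \<open>scale\<close> of a vector space, compatible with the ring multiplication.
\<close>

locale k_algebra = vector_space scale
  for scale :: "'k::field \<Rightarrow> 'b::comm_ring_1 \<Rightarrow> 'b" +
  assumes scale_mult_left: "scale c x * y = scale c (x * y)"

definition subalgebra :: "('k::field \<Rightarrow> 'b::comm_ring_1 \<Rightarrow> 'b) \<Rightarrow> 'b set \<Rightarrow> bool" where
  "subalgebra scale A \<longleftrightarrow>
     module.subspace scale A \<and> 1 \<in> A \<and> (\<forall>x\<in>A. \<forall>y\<in>A. x * y \<in> A)"

definition finitely_generated_algebra :: "('k::field \<Rightarrow> 'b::comm_ring_1 \<Rightarrow> 'b) \<Rightarrow> bool" where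
  "finitely_generated_algebra scale \<longleftrightarrow> (\<exists>S. finite S \<and> subalgebra scale hull S = UNIV)"

definition k_derivation :: "('k::field \<Rightarrow> 'b::comm_ring_1 \<Rightarrow> 'b) \<Rightarrow> ('b \<Rightarrow> 'b) \<Rightarrow> bool" where
  "k_derivation scale D \<longleftrightarrow>
     Vector_Spaces.linear scale scale D \<and> (\<forall>x y. D (x * y) = D x * y + x * D y)"

definition locally_nilpotent :: "('b::zero \<Rightarrow> 'b) \<Rightarrow> bool" where
  "locally_nilpotent D \<longleftrightarrow> (\<forall>b. \<exists>m\<ge>1. (D ^^ m) b = 0)"

text \<open>
  The Laurent polynomial ring \<open>B[t, t\<^sup>-\<^sup>1]\<close> is the group ring of the integers: finitely supported
  maps from exponents to coefficients, with the convolution product of \<^theory>\<open>HOL-Library.Poly_Mapping\<close>.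
  The monomial \<open>b t\<^sup>n\<close> is \<open>Poly_Mapping.single n b\<close>.
\<close>

type_synonym 'b laurent = "int \<Rightarrow>\<^sub>0 'b"

definition laurent_const :: "'b::comm_ring_1 \<Rightarrow> 'b laurent" where
  "laurent_const b = Poly_Mapping.single 0 b"

definition laurent_deriv :: "'b::comm_ring_1 laurent \<Rightarrow> 'b laurent" where
  "laurent_deriv p =
     (\<Sum>n\<in>Poly_Mapping.keys p. Poly_Mapping.single (n - 1) (of_int n * Poly_Mapping.lookup p n))"

definition eval_at_1 :: "'b::comm_ring_1 laurent \<Rightarrow> 'b" where
  "eval_at_1 p = (\<Sum>n\<in>Poly_Mapping.keys p. Poly_Mapping.lookup p n)"

text \<open>
  A coaction of the multiplicative group on \<open>B\<close>: an algebra homomorphism from \<open>B\<close> to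
  \<open>B[t, t\<^sup>-\<^sup>1]\<close> that is counital and coassociative. The latter is an identity in
  \<open>B[t, t\<^sup>-\<^sup>1][u, u\<^sup>-\<^sup>1]\<close>: on the left, \<open>b t\<^sup>n\<close> is sent to \<open>\<beta>(b) u\<^sup>n\<close>; on the right, \<open>b t\<^sup>n\<close> is sent
  to \<open>b t\<^sup>n u\<^sup>n\<close>.
\<close>

definition Gm_coaction ::
  "('k::field \<Rightarrow> 'b::comm_ring_1 \<Rightarrow> 'b) \<Rightarrow> ('b \<Rightarrow> 'b laurent) \<Rightarrow> bool" where
  "Gm_coaction scale \<beta> \<longleftrightarrow>
     \<beta> 1 = 1 \<and>
     (\<forall>x y. \<beta> (x + y) = \<beta> x + \<beta> y) \<and>
     (\<forall>x y. \<beta> (x * y) = \<beta> x * \<beta> y) \<and>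
     (\<forall>c x. \<beta> (scale c x) = Poly_Mapping.map (scale c) (\<beta> x)) \<and>
     (\<forall>x. eval_at_1 (\<beta> x) = x) \<and>
     (\<forall>x. Poly_Mapping.map \<beta> (\<beta> x) =
        (\<Sum>n\<in>Poly_Mapping.keys (\<beta> x).
           Poly_Mapping.single n (Poly_Mapping.single n (Poly_Mapping.lookup (\<beta> x) n))))"

definition infinitesimal_generator :: "('b::comm_ring_1 \<Rightarrow> 'b laurent) \<Rightarrow> 'b \<Rightarrow> 'b" where
  "infinitesimal_generator \<beta> = eval_at_1 \<circ> laurent_deriv \<circ> \<beta>"

text \<open>
  \<open>exp(-\<lambda>D)(b)\<close> as an element of \<open>B[\<lambda>]\<close>, with \<open>\<lambda> = [:0, 1:]\<close>. The sum has finite support when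
  \<open>D\<close> is locally nilpotent (otherwise it is 0 by the convention for \<^const>\<open>Sum_any\<close>).
\<close>

definition exp_neg_lambda ::
  "('k::field_char_0 \<Rightarrow> 'b::comm_ring_1 \<Rightarrow> 'b) \<Rightarrow> ('b \<Rightarrow> 'b) \<Rightarrow> 'b \<Rightarrow> 'b poly" where
  "exp_neg_lambda scale D b =
     Sum_any (\<lambda>j. smult (scale (inverse (fact j)) ((D ^^ j) b)) ((- [:0, 1:]) ^ j))"

text \<open>Evaluation of \<open>exp(-\<lambda>D)(b)\<close> at \<open>\<lambda> = (1 - t\<^sup>N) s\<close> in \<open>B[t, t\<^sup>-\<^sup>1]\<close>.\<close>

definition freudenburg_coaction ::
  "('k::field_char_0 \<Rightarrow> 'b::comm_ring_1 \<Rightarrow> 'b) \<Rightarrow> ('b \<Rightarrow> 'b) \<Rightarrow> 'b \<Rightarrow> int \<Rightarrow> 'b \<Rightarrow> 'b laurent" where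
  "freudenburg_coaction scale D s N b =
     poly (map_poly laurent_const (exp_neg_lambda scale D b))
       ((1 - Poly_Mapping.single N 1) * laurent_const s)"

end

theory Submission
  imports Defs
begin

text \<open>
  Write \<open>A\<close> for the kernel of \<open>D\<close>. A slice makes \<open>B\<close> a polynomial ring over \<open>A\<close>: every element
  is a sum of terms \<open>a s\<^sup>n\<close> with \<open>a \<in> A\<close>. On such a term \<open>D\<close> acts as \<open>d/ds\<close>, so \<open>exp(-\<lambda>D)\<close> is the
  Taylor shift \<open>s \<mapsto> s - \<lambda>\<close>, and at \<open>\<lambda> = (1 - t\<^sup>N) s\<close> the shifted variable is \<open>t\<^sup>N s\<close>. Hence
  \<open>\<beta>(a s\<^sup>n) = a s\<^sup>n t\<^sup>N\<^sup>n\<close>: Freudenburg's action is the one that belongs to the grading of \<open>B = A[s]\<close> in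
  which \<open>A\<close> has degree \<open>0\<close> and \<open>s\<close> has degree \<open>N\<close>.

  Every assertion of the theorem about \<open>\<beta>\<close> is additive in each argument, so it needs to be checked only
  on these homogeneous terms (rule \<open>slice_induct\<close>), where \<open>\<beta>\<close> is given by
  \<open>freudenburg_homogeneous\<close>. The generator multiplies \<open>a s\<^sup>n\<close> by its degree \<open>N n\<close>, and so does
  \<open>N s D\<close>, because \<open>s D(a s\<^sup>n) = n a s\<^sup>n\<close>.
\<close>

section \<open>Additive maps on Laurent polynomials\<close>

lemma eval_at_1_add: "eval_at_1 (p + q) = eval_at_1 p + eval_at_1 q"
  unfolding eval_at_1_def by (rule setsum_keys_plus_distrib) auto

lemma eval_at_1_single: "eval_at_1 (Poly_Mapping.single n b) = b"
  by (simp add: eval_at_1_def)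

lemma laurent_deriv_add: "laurent_deriv (p + q) = laurent_deriv p + laurent_deriv q"
  unfolding laurent_deriv_def
  by (rule setsum_keys_plus_distrib) (auto simp: single_add distrib_left)

lemma laurent_deriv_single:
  "laurent_deriv (Poly_Mapping.single n b) = Poly_Mapping.single (n - 1) (of_int n * b)"
  by (simp add: laurent_deriv_def)

lemma poly_mapping_map_add:
  fixes p q :: "'i \<Rightarrow>\<^sub>0 'b::monoid_add" and f :: "'b \<Rightarrow> 'c::monoid_add"
  assumes "\<And>x y. f (x + y) = f x + f y" and "f 0 = 0"
  shows "Poly_Mapping.map f (p + q) = Poly_Mapping.map f p + Poly_Mapping.map f q"
proof (rule poly_mapping_eqI)
  have "Poly_Mapping.lookup (Poly_Mapping.map f r) k = f (Poly_Mapping.lookup r k)"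
    for r :: "'i \<Rightarrow>\<^sub>0 'b" and k
    using assms(2) by (simp add: Poly_Mapping.map.rep_eq when_def)
  then show "Poly_Mapping.lookup (Poly_Mapping.map f (p + q)) k =
      Poly_Mapping.lookup (Poly_Mapping.map f p + Poly_Mapping.map f q) k" for k
    by (simp add: lookup_add assms(1))
qed

text \<open>For the right-hand side of coassociativity.\<close>

lemma diagonal_add:
  fixes p q :: "'b::comm_ring_1 laurent"
  shows "(\<Sum>n\<in>Poly_Mapping.keys (p + q).
            Poly_Mapping.single n (Poly_Mapping.single n (Poly_Mapping.lookup (p + q) n))) =
         (\<Sum>n\<in>Poly_Mapping.keys p. Poly_Mapping.single n (Poly_Mapping.single n (Poly_Mapping.lookup p n))) +
         (\<Sum>n\<in>Poly_Mapping.keys q. Poly_Mapping.single n (Poly_Mapping.single n (Poly_Mapping.lookup q n)))"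
  by (rule setsum_keys_plus_distrib) (auto simp: single_add)

lemma laurent_const_add: "laurent_const (a + b) = laurent_const a + laurent_const b"
  by (simp add: laurent_const_def single_add)

lemma laurent_const_mult: "laurent_const (a * b) = laurent_const a * laurent_const b"
  by (simp add: laurent_const_def mult_single)

lemma laurent_const_0 [simp]: "laurent_const 0 = 0"
  by (simp add: laurent_const_def)

section \<open>Evaluating a polynomial at a Laurent polynomial\<close>

definition laurent_eval :: "'b::comm_ring_1 laurent \<Rightarrow> 'b poly \<Rightarrow> 'b laurent" where
  "laurent_eval x p = poly (map_poly laurent_const p) x"

lemma laurent_eval_0 [simp]: "laurent_eval x 0 = 0"
  by (simp add: laurent_eval_def)

lemma laurent_eval_pCons:
  "laurent_eval x (pCons a p) = laurent_const a + x * laurent_eval x p"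
  by (simp add: laurent_eval_def map_poly_pCons)

lemma laurent_eval_add: "laurent_eval x (p + q) = laurent_eval x p + laurent_eval x q"
  by (induction p q rule: poly_induct2)
     (simp_all add: laurent_eval_pCons laurent_const_add algebra_simps)

lemma laurent_eval_smult: "laurent_eval x (smult a p) = laurent_const a * laurent_eval x p"
  by (induction p) (simp_all add: laurent_eval_pCons laurent_const_mult algebra_simps)

lemma laurent_eval_linear_power:
  "laurent_eval x ([:a, b:] ^ n) = (laurent_const a + x * laurent_const b) ^ n"
proof (induction n)
  case 0
  show ?case
    using laurent_eval_pCons[of x 1 0] by (simp add: laurent_const_def one_pCons)
next
  case (Suc n)
  have "[:a, b:] ^ Suc n = smult a ([:a, b:] ^ n) + pCons 0 (smult b ([:a, b:] ^ n))"
    by simp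
  then show ?case
    by (simp only: Suc.IH laurent_eval_add laurent_eval_smult laurent_eval_pCons)
       (simp add: algebra_simps)
qed

lemma single_power:
  fixes b :: "'b::comm_ring_1"
  shows "Poly_Mapping.single (N::int) b ^ n = Poly_Mapping.single (N * int n) (b ^ n)"
  by (induction n) (simp_all add: mult_single algebra_simps)

section \<open>Locally nilpotent derivations with a slice\<close>

context k_algebra
begin

lemma scale_mult_right: "scale c (x * y) = x * scale c y"
  by (metis mult.commute scale_mult_left)

lemma scale_of_nat: "scale (of_nat n) x = of_nat n * x"
  by (induction n) (simp_all add: scale_left_distrib distrib_right)

end

locale derivation_with_slice = k_algebra scale
  for scale :: "'k::field_char_0 \<Rightarrow> 'b::comm_ring_1 \<Rightarrow> 'b" +
  fixes D :: "'b \<Rightarrow> 'b" and s :: 'b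
  assumes derivation: "k_derivation scale D"
    and nilpotent: "locally_nilpotent D"
    and slice: "D s = 1"
begin

lemma D_add: "D (x + y) = D x + D y"
  and D_scale: "D (scale c x) = scale c (D x)"
  and D_mult: "D (x * y) = D x * y + x * D y"
proof -
  interpret D: Vector_Spaces.linear scale scale D
    using derivation by (simp add: k_derivation_def)
  show "D (x + y) = D x + D y" "D (scale c x) = scale c (D x)"
    by (rule D.add D.scale)+
  show "D (x * y) = D x * y + x * D y"
    using derivation by (simp add: k_derivation_def)
qed

lemma D_0: "D 0 = 0"
  using D_add[of 0 0] by simp

lemma D_diff: "D (x - y) = D x - D y"
  using D_add[of "x - y" y] by simp

lemma D_1: "D 1 = 0"
  using D_mult[of 1 1] by simp

lemma D_of_nat_mult: "D (of_nat n * x) = of_nat n * D x"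
  by (metis D_scale scale_of_nat)

lemma D_slice_power: "D (s ^ n) = of_nat n * s ^ (n - 1)"
proof (induction n)
  case (Suc n)
  then show ?case
    by (cases n) (simp_all add: D_mult slice algebra_simps)
qed (simp add: D_1)

lemma D_homogeneous: "D a = 0 \<Longrightarrow> D (a * s ^ n) = of_nat n * (a * s ^ (n - 1))"
  by (simp add: D_mult D_slice_power algebra_simps)

lemma iterate_D_0: "(D ^^ j) 0 = 0"
  by (induction j) (simp_all add: D_0)

lemma iterate_D_add: "(D ^^ j) (x + y) = (D ^^ j) x + (D ^^ j) y"
  by (induction j) (simp_all add: D_add)

lemma iterate_D_eventually_0: "\<exists>m. \<forall>j\<ge>m. (D ^^ j) b = 0"
proof -
  obtain m where m: "(D ^^ m) b = 0"
    using nilpotent by (auto simp: locally_nilpotent_def)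
  have "(D ^^ j) b = 0" if "j \<ge> m" for j
  proof -
    have "(D ^^ j) b = (D ^^ (j - m)) ((D ^^ m) b)"
      using that by (metis comp_apply funpow_add le_add_diff_inverse2)
    then show ?thesis
      by (simp add: m iterate_D_0)
  qed
  then show ?thesis by blast
qed

lemma iterate_D_homogeneous:
  assumes "D a = 0"
  shows "(D ^^ j) (a * s ^ n) = of_nat (fact j * (n choose j)) * (a * s ^ (n - j))"
proof (induction j)
  case (Suc j)
  have "(n - j) * (n choose j) = Suc j * (n choose Suc j)"
    by (simp only: binomial_absorb_comp binomial_absorption)
  then have choose: "fact j * (n choose j) * (n - j) = fact (Suc j) * (n choose Suc j)"
    by (simp only: fact_Suc of_nat_id mult_ac)
  have "(D ^^ Suc j) (a * s ^ n) =
        of_nat (fact j * (n choose j)) * (of_nat (n - j) * (a * s ^ (n - j - 1)))"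
    by (simp only: funpow.simps comp_apply Suc.IH D_of_nat_mult D_homogeneous[OF assms])
  also have "\<dots> = of_nat (fact j * (n choose j) * (n - j)) * (a * s ^ (n - Suc j))"
    by (simp add: mult.assoc)
  finally show ?case
    by (simp only: choose)
qed simp

text \<open>The additive span of the terms \<open>a s\<^sup>n\<close> with \<open>a\<close> in the kernel of \<open>D\<close>, that is, the subring \<open>A[s]\<close>.\<close>

inductive_set slice_sums :: "'b set" where
  homogeneous: "D a = 0 \<Longrightarrow> a * s ^ n \<in> slice_sums"
| add: "x \<in> slice_sums \<Longrightarrow> y \<in> slice_sums \<Longrightarrow> x + y \<in> slice_sums"

text \<open>
  In characteristic zero, \<open>a s\<^sup>n\<close> has the antiderivative \<open>(a/(n + 1)) s\<^sup>n\<^sup>+\<^sup>1\<close>, whose coefficient is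
  again in the kernel.
\<close>

lemma slice_sums_antiderivative:
  assumes "x \<in> slice_sums"
  shows "\<exists>c\<in>slice_sums. D c = x"
  using assms
proof induction
  case (homogeneous a n)
  let ?a = "scale (inverse (of_nat (Suc n))) a"
  have "D ?a = 0"
    by (simp add: D_scale homogeneous)
  moreover from this have "D (?a * s ^ Suc n) = of_nat (Suc n) * (?a * s ^ n)"
    by (simp only: D_homogeneous) simp
  then have "D (?a * s ^ Suc n) = a * s ^ n"
    by (simp only: scale_of_nat[symmetric] scale_mult_left scale_scale)
       (simp del: of_nat_Suc)
  ultimately show ?case
    by (metis slice_sums.homogeneous)
next
  case (add x y)
  then show ?case
    by (metis D_add slice_sums.add)
qed

text \<open>
  This is \<open>B = A[s]\<close>, by induction on the number of applications of \<open>D\<close> that annihilate \<open>b\<close>: if \<open>D b\<close>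
  lies in \<open>A[s]\<close>, then \<open>b\<close> differs from an antiderivative \<open>c \<in> A[s]\<close> of \<open>D b\<close> by an element of the
  kernel.
\<close>

lemma slice_sums_UNIV: "b \<in> slice_sums"
proof -
  have "b \<in> slice_sums" if "(D ^^ m) b = 0" for m
    using that
  proof (induction m arbitrary: b)
    case 0
    then show ?case
      using slice_sums.homogeneous[of 0 0] by (simp add: D_0)
  next
    case (Suc m)
    then have "D b \<in> slice_sums"
      by (simp only: funpow_Suc_right comp_apply)
    then obtain c where c: "c \<in> slice_sums" "D c = D b"
      using slice_sums_antiderivative by blast
    then have "(b - c) * s ^ 0 \<in> slice_sums"
      by (intro slice_sums.homogeneous) (simp add: D_diff)
    with c(1) have "(b - c) * s ^ 0 + c \<in> slice_sums"
      by (rule slice_sums.add[rotated])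
    then show ?case by simp
  qed
  then show ?thesis
    using iterate_D_eventually_0 by blast
qed

lemma slice_induct [case_names homogeneous add]:
  assumes "\<And>a n. D a = 0 \<Longrightarrow> P (a * s ^ n)"
    and "\<And>x y. P x \<Longrightarrow> P y \<Longrightarrow> P (x + y)"
  shows "P b"
  using slice_sums_UNIV[of b] by induction (use assms in auto)

section \<open>The exponential and Freudenburg's coaction\<close>

text \<open>
  Local nilpotency makes the support of the exponential series finite, and only then
  is \<^const>\<open>Sum_any\<close> the sum of the series.
\<close>

lemma coeff_exp_neg_lambda:
  "coeff (exp_neg_lambda scale D b) i = (- 1) ^ i * scale (inverse (fact i)) ((D ^^ i) b)"
proof -
  let ?f = "\<lambda>j. smult (scale (inverse (fact j)) ((D ^^ j) b)) ((- [:0, 1:]) ^ j)"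
  obtain m where m: "\<And>j. j \<ge> m \<Longrightarrow> (D ^^ j) b = 0"
    using iterate_D_eventually_0 by blast
  have f: "?f j = monom ((- 1) ^ j * scale (inverse (fact j)) ((D ^^ j) b)) j" for j
  proof -
    have "- [:0, 1:] = monom (- 1 :: 'b) 1"
      by (simp add: monom_altdef)
    then have "(- [:0, 1:]) ^ j = monom ((- 1 :: 'b) ^ j) j"
      by (simp only: monom_power) simp
    then show ?thesis
      by (simp add: smult_monom mult.commute)
  qed
  have "exp_neg_lambda scale D b = (\<Sum>j<max m (Suc i). ?f j)"
    unfolding exp_neg_lambda_def
  proof (rule Sum_any.expand_superset)
    show "{j. ?f j \<noteq> 0} \<subseteq> {..<max m (Suc i)}"
    proof
      fix j assume "j \<in> {j. ?f j \<noteq> 0}"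
      then have "(D ^^ j) b \<noteq> 0" by auto
      then have "j < m" using m not_less by blast
      then show "j \<in> {..<max m (Suc i)}" by simp
    qed
  qed simp
  then show ?thesis
    unfolding f by (simp add: coeff_sum coeff_monom)
qed

lemma exp_neg_lambda_add:
  "exp_neg_lambda scale D (x + y) = exp_neg_lambda scale D x + exp_neg_lambda scale D y"
  by (rule poly_eqI)
     (simp add: coeff_exp_neg_lambda iterate_D_add scale_right_distrib distrib_left)

text \<open>The binomial coefficients in \<open>D\<^sup>j(a s\<^sup>n)/j!\<close> are those of the expansion of \<open>(s - \<lambda>)\<^sup>n\<close>.\<close>

lemma exp_neg_lambda_homogeneous:
  assumes "D a = 0"
  shows "exp_neg_lambda scale D (a * s ^ n) = smult a ([:s, - 1:] ^ n)"
proof (rule poly_eqI)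
  fix i
  have "scale (inverse (fact i)) ((D ^^ i) (a * s ^ n)) =
        scale (inverse (fact i) * of_nat (fact i * (n choose i))) (a * s ^ (n - i))"
    by (simp only: iterate_D_homogeneous[OF assms] scale_of_nat[symmetric] scale_scale)
  also have "inverse (fact i) * of_nat (fact i * (n choose i)) = (of_nat (n choose i) :: 'k)"
    by simp
  finally have "scale (inverse (fact i)) ((D ^^ i) (a * s ^ n)) =
      of_nat (n choose i) * (a * s ^ (n - i))"
    by (simp only: scale_of_nat)
  moreover have "coeff ([:s, - 1:] ^ n) i = of_nat (n choose i) * (- 1) ^ i * s ^ (n - i)"
  proof (cases "i \<le> n")
    case True
    then show ?thesis by (rule coeff_linear_poly_power)
  next
    case False
    have "degree ([:s, - 1:] ^ n) \<le> n"
      using degree_power_le[of "[:s, - 1:]" n] by simp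
    with False show ?thesis
      by (simp add: coeff_eq_0 binomial_eq_0)
  qed
  ultimately show "coeff (exp_neg_lambda scale D (a * s ^ n)) i = coeff (smult a ([:s, - 1:] ^ n)) i"
    by (simp add: coeff_exp_neg_lambda mult_ac)
qed

context
  fixes N :: int
begin

abbreviation \<beta> :: "'b \<Rightarrow> 'b laurent" where
  "\<beta> \<equiv> freudenburg_coaction scale D s N"

lemma freudenburg_eq_laurent_eval:
  "\<beta> b = laurent_eval ((1 - Poly_Mapping.single N 1) * laurent_const s) (exp_neg_lambda scale D b)"
  by (simp add: freudenburg_coaction_def laurent_eval_def)

lemma freudenburg_add: "\<beta> (x + y) = \<beta> x + \<beta> y"
  by (simp add: freudenburg_eq_laurent_eval exp_neg_lambda_add laurent_eval_add)

lemma freudenburg_0: "\<beta> 0 = 0"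
  using freudenburg_add[of 0 0] by simp

text \<open>
  Substituting \<open>\<lambda> = (1 - t\<^sup>N) s\<close> turns \<open>s - \<lambda>\<close> into \<open>t\<^sup>N s\<close>, so \<open>a s\<^sup>n\<close> is homogeneous of degree
  \<open>N n\<close> for the coaction.
\<close>

lemma freudenburg_homogeneous:
  assumes "D a = 0"
  shows "\<beta> (a * s ^ n) = Poly_Mapping.single (N * int n) (a * s ^ n)"
proof -
  let ?x = "(1 - Poly_Mapping.single N 1) * laurent_const s"
  have minus_one: "laurent_const (- 1 :: 'b) = - 1"
    by (simp add: laurent_const_def single_uminus)
  have "laurent_const s + ?x * laurent_const (- 1) = Poly_Mapping.single N s"
    unfolding minus_one by (simp add: laurent_const_def algebra_simps mult_single)
  then have "\<beta> (a * s ^ n) = laurent_const a * Poly_Mapping.single N s ^ n"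
    by (simp only: freudenburg_eq_laurent_eval exp_neg_lambda_homogeneous[OF assms]
          laurent_eval_smult laurent_eval_linear_power)
  then show ?thesis
    by (simp add: laurent_const_def single_power mult_single)
qed

text \<open>Degrees add under multiplication because the kernel of \<open>D\<close> is closed under products.\<close>

lemma freudenburg_mult: "\<beta> (x * y) = \<beta> x * \<beta> y"
proof (induction x rule: slice_induct)
  case (homogeneous a n)
  note a = homogeneous
  show ?case
  proof (induction y rule: slice_induct)
    case (homogeneous b m)
    have "D (a * b) = 0"
      by (simp add: D_mult a homogeneous)
    then have "\<beta> ((a * b) * s ^ (n + m)) =
        Poly_Mapping.single (N * int (n + m)) ((a * b) * s ^ (n + m))"
      by (rule freudenburg_homogeneous)
    then show ?case
      by (simp add: freudenburg_homogeneous a homogeneous mult_single power_add algebra_simps)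
  next
    case (add x y)
    then show ?case
      by (simp add: freudenburg_add distrib_left)
  qed
next
  case (add x y)
  then show ?case
    by (simp add: freudenburg_add distrib_right)
qed

lemma freudenburg_scale: "\<beta> (scale c x) = Poly_Mapping.map (scale c) (\<beta> x)"
proof (induction x rule: slice_induct)
  case (homogeneous a n)
  then have "D (scale c a) = 0"
    by (simp add: D_scale)
  from freudenburg_homogeneous[OF this, of n] show ?case
    by (simp add: freudenburg_homogeneous homogeneous scale_mult_left)
next
  case (add x y)
  then show ?case
    by (simp add: freudenburg_add poly_mapping_map_add scale_right_distrib)
qed

lemma freudenburg_counit: "eval_at_1 (\<beta> x) = x"
  by (induction x rule: slice_induct)
     (simp_all add: freudenburg_homogeneous freudenburg_add eval_at_1_single eval_at_1_add)

lemma freudenburg_coassociative: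
  "Poly_Mapping.map \<beta> (\<beta> x) =
     (\<Sum>n\<in>Poly_Mapping.keys (\<beta> x).
        Poly_Mapping.single n (Poly_Mapping.single n (Poly_Mapping.lookup (\<beta> x) n)))"
proof (induction x rule: slice_induct)
  case (homogeneous a n)
  then show ?case
    by (simp add: freudenburg_homogeneous freudenburg_0)
next
  case (add x y)
  then show ?case
    by (simp only: freudenburg_add poly_mapping_map_add[OF freudenburg_add freudenburg_0]
          diagonal_add)
qed

lemma freudenburg_Gm_coaction: "Gm_coaction scale \<beta>"
  unfolding Gm_coaction_def
  using freudenburg_homogeneous[OF D_1, of 0]
  by (simp add: freudenburg_add freudenburg_mult freudenburg_scale freudenburg_counit
        freudenburg_coassociative)

lemma freudenburg_infinitesimal_generator:
  "infinitesimal_generator \<beta> b = of_int N * s * D b"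
proof (induction b rule: slice_induct)
  case (homogeneous a n)
  have "of_int (N * int n) * (a * s ^ n) = of_int N * s * D (a * s ^ n)"
    unfolding D_homogeneous[OF homogeneous] by (cases n) (simp_all add: algebra_simps)
  then show ?case
    by (simp add: infinitesimal_generator_def freudenburg_homogeneous homogeneous
          laurent_deriv_single eval_at_1_single)
next
  case (add x y)
  then show ?case
    by (simp add: infinitesimal_generator_def freudenburg_add laurent_deriv_add eval_at_1_add
          D_add distrib_left)
qed

end

lemma k_derivation_mult: "k_derivation scale (\<lambda>b. f * D b)"
proof -
  have "Vector_Spaces.linear scale scale (\<lambda>b. f * D b)"
    by unfold_locales (simp_all add: D_add D_scale distrib_left scale_mult_right)
  then show ?thesis
    by (simp add: k_derivation_def D_mult algebra_simps)
qed

end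

theorem corollary4p3:
  fixes scale :: "'k::{alg_closed_field, field_char_0} \<Rightarrow> 'b::idom \<Rightarrow> 'b"
    and D :: "'b \<Rightarrow> 'b" and s :: 'b and N :: int
  assumes "k_algebra scale"
    and "finitely_generated_algebra scale"
    and "k_derivation scale D"
    and "locally_nilpotent D"
    and "D s = 1"
    and "N \<noteq> 0"
  shows "Gm_coaction scale (freudenburg_coaction scale D s N) \<and>
    k_derivation scale (\<lambda>b. of_int N * s * D b) \<and>
    infinitesimal_generator (freudenburg_coaction scale D s N) = (\<lambda>b. of_int N * s * D b)"
proof -
  interpret derivation_with_slice scale D s
    using assms by (simp add: derivation_with_slice_def derivation_with_slice_axioms_def)
  show ?thesis
    using freudenburg_Gm_coaction k_derivation_mult freudenburg_infinitesimal_generator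
    by (simp add: fun_eq_iff)
qed

end
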